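(* Let $0<\alpha_0<\alpha_1<1$, let $\nu=p_1\delta_{\alpha_0}+p_2\delta_{\alpha_1}$ with $p_1,p_2>0$, $p_1+p_2=1$, and let $\Omega=[\alpha_0,\alpha_1]^{\mathbb Z}$, $P=\nu^{\mathbb Z}$. Then for $P$-almost every $\omega\in\Omega$, as $\ell\to\infty$, $$x_\ell(\omega)\sim\left[\frac{1}{c(\nu)\,\ell}\right]^{\frac1{\alpha_0}},\qquad\text{where } c(\nu)=\alpha_02^{\alpha_0}p_1.$$
   Context: For $0<\alpha<1$ the LSV map $f_\alpha:[0,1]\to[0,1]$ is $f_\alpha(x)=x(1+2^\alpha x^\alpha)$ for $x\in[0,\frac12]$ and $f_\alpha(x)=2x-1$ for $x\in(\frac12,1]$. For $\omega\in\Omega$ let $\alpha(\omega)\in[\alpha_0,\alpha_1]$ be its zeroth coordinate and $f_\omega:=f_{\alpha(\omega)}$; $\sigma$ is the left shift on $\Omega$. Define $x_1(\omega)=\frac12$ and $x_n(\omega)=\left(f_\omega|_{(0,1/2]}\right)^{-1}x_{n-1}(\sigma\omega)$ for $n\ge2$. The notation $a_\ell\sim b_\ell$ means $a_\ell/b_\ell\to1$. *)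

theory Defs
  imports "HOL-Probability.Probability" "HOL-Library.Landau_Symbols"
begin

definition lsv :: "real \<Rightarrow> real \<Rightarrow> real" where
  "lsv \<alpha> x = (if x \<le> 1/2 then x * (1 + 2 powr \<alpha> * x powr \<alpha>) else 2 * x - 1)"

definition shift :: "(int \<Rightarrow> 'a) \<Rightarrow> int \<Rightarrow> 'a" where
  "shift \<omega> = (\<lambda>i. \<omega> (i + 1))"

text \<open>
  The sequence starts at index 1. The value at 0 is a dummy; 1 is chosen because it makes the
  recursion valid at index 1 as well, every left branch mapping 1/2 to 1.
  By \<open>lsv_bij_betw\<close> below, the inverse is only ever taken at points of the range.
\<close>
fun lsv_pt :: "nat \<Rightarrow> (int \<Rightarrow> real) \<Rightarrow> real" where
  "lsv_pt 0 \<omega> = 1"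
| "lsv_pt (Suc 0) \<omega> = 1/2"
| "lsv_pt (Suc (Suc n)) \<omega> =
     the_inv_into {0<..1/2} (lsv (\<omega> 0)) (lsv_pt (Suc n) (shift \<omega>))"

text \<open>
  The measure \<open>p1 \<delta>\<^sub>a + p2 \<delta>\<^sub>b\<close> on the Borel sets of the interval from \<open>a\<close> to \<open>b\<close>.
\<close>
definition two_point :: "real \<Rightarrow> real \<Rightarrow> real \<Rightarrow> real \<Rightarrow> real measure" where
  "two_point p1 a p2 b =
     (let X = restrict_space borel {a..b} in
      measure_of (space X) (sets X)
        (\<lambda>A. ennreal p1 * emeasure (return X a) A + ennreal p2 * emeasure (return X b) A))"

lemma space_two_point [simp]: "space (two_point p1 a p2 b) = {a..b}"
  by (simp add: two_point_def Let_def space_measure_of_conv space_restrict_space)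

lemma sets_two_point [simp]: "sets (two_point p1 a p2 b) = sets (restrict_space borel {a..b})"
  unfolding two_point_def Let_def by (rule sets.sets_measure_of_eq)

lemma emeasure_two_point:
  assumes "A \<in> sets (restrict_space borel {a..b})"
  shows "emeasure (two_point p1 a p2 b) A =
           ennreal p1 * indicator A a + ennreal p2 * indicator A b"
proof -
  let ?X = "restrict_space (borel :: real measure) {a..b}"
  have "emeasure (two_point p1 a p2 b) A =
          ennreal p1 * emeasure (return ?X a) A + ennreal p2 * emeasure (return ?X b) A"
    unfolding two_point_def Let_def
  proof (rule emeasure_measure_of_sigma)
    show "sigma_algebra (space ?X) (sets ?X)" ..
    show "positive (sets ?X)
        (\<lambda>A. ennreal p1 * emeasure (return ?X a) A + ennreal p2 * emeasure (return ?X b) A)"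
      by (simp add: positive_def)
    show "countably_additive (sets ?X)
        (\<lambda>A. ennreal p1 * emeasure (return ?X a) A + ennreal p2 * emeasure (return ?X b) A)"
      unfolding countably_additive_def
    proof (intro allI impI)
      fix F :: "nat \<Rightarrow> real set"
      assume F: "range F \<subseteq> sets ?X" "disjoint_family F"
      have "(\<Sum>i. emeasure (return ?X c) (F i)) = emeasure (return ?X c) (\<Union>i. F i)" for c
        by (rule suminf_emeasure) (use F in auto)
      then show "(\<Sum>i. ennreal p1 * emeasure (return ?X a) (F i)
              + ennreal p2 * emeasure (return ?X b) (F i)) =
          ennreal p1 * emeasure (return ?X a) (\<Union>i. F i)
            + ennreal p2 * emeasure (return ?X b) (\<Union>i. F i)"
        by (simp add: suminf_add[symmetric] ennreal_suminf_cmult)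
    qed
  qed (use assms in simp)
  then show ?thesis using assms by simp
qed

lemma prob_space_two_point:
  assumes "a \<le> b" "0 \<le> p1" "0 \<le> p2" "p1 + p2 = 1"
  shows "prob_space (two_point p1 a p2 b)"
proof (rule prob_spaceI)
  have "{a..b} \<in> sets (restrict_space borel {a..b})"
    by (simp add: sets_restrict_space_iff)
  then show "emeasure (two_point p1 a p2 b) (space (two_point p1 a p2 b)) = 1"
    using assms by (simp add: emeasure_two_point ennreal_plus[symmetric] del: ennreal_plus)
qed

lemma lsv_bij_betw:
  assumes "0 < \<alpha>"
  shows "bij_betw (lsv \<alpha>) {0<..1/2} {0<..1}"
proof -
  let ?g = "\<lambda>x::real. x * (1 + 2 powr \<alpha> * x powr \<alpha>)"
  have eq: "lsv \<alpha> x = ?g x" if "x \<le> 1/2" for x using that by (simp add: lsv_def)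
  have half: "?g (1/2) = 1" by (simp add: powr_mult[symmetric] powr_divide)
  have less: "?g x < ?g y" if "0 \<le> x" "x < y" for x y
  proof -
    have "x powr \<alpha> \<le> y powr \<alpha>" using that assms by (intro powr_mono2) auto
    then show ?thesis using that by (intro mult_less_le_imp_less) (auto simp: add_pos_nonneg)
  qed
  have inj: "inj_on (lsv \<alpha>) {0<..1/2}"
  proof (rule linorder_inj_onI')
    fix i j assume "i \<in> {0<..1/2::real}" "j \<in> {0<..1/2::real}" "i < j"
    then show "lsv \<alpha> i \<noteq> lsv \<alpha> j" using less[of i j] by (simp add: eq)
  qed
  have cont: "continuous_on {0..1/2} ?g"
    using assms by (intro continuous_intros continuous_on_powr') auto
  have "lsv \<alpha> ` {0<..1/2} = {0<..1}"
  proof (intro equalityI subsetI)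
    fix y assume "y \<in> lsv \<alpha> ` {0<..1/2}"
    then obtain x where x: "0 < x" "x \<le> 1/2" "y = ?g x" by (auto simp: eq)
    have "x < 1/2 \<or> x = 1/2" using x by linarith
    then have "?g x \<le> 1"
    proof
      assume "x < 1/2"
      then show ?thesis using less[of x "1/2"] half x by linarith
    next
      assume "x = 1/2"
      then show ?thesis using half by (simp only:)
    qed
    moreover have "0 < ?g x" using less[of 0 x] x by simp
    ultimately show "y \<in> {0<..1}" using x by simp
  next
    fix y :: real assume y: "y \<in> {0<..1}"
    obtain x where x: "0 \<le> x" "x \<le> 1/2" "?g x = y"
      using IVT'[of ?g 0 y "1/2"] y half cont by auto
    then have "0 < x" using y by (cases "x = 0") auto
    then show "y \<in> lsv \<alpha> ` {0<..1/2}" using x eq by (intro image_eqI[of _ _ x]) auto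
  qed
  with inj show ?thesis by (simp add: bij_betw_def)
qed

end

theory Submission
  imports Defs "HOL-Real_Asymp.Real_Asymp"
begin

text \<open>
  Pulling \<open>x\<close> back along the left branch with exponent \<open>\<alpha>0\<close> raises \<open>x powr - \<alpha>0\<close> by
  \<open>\<alpha>0 * 2 powr \<alpha>0 + o(1)\<close> as \<open>x\<close> tends to 0, while the branch with exponent \<open>\<alpha>1 > \<alpha>0\<close> raises
  it by \<open>o(1)\<close> only. The points \<open>lsv_pt n \<omega>\<close> tend to 0 uniformly in \<open>\<omega>\<close>, so up to an error
  \<open>o(n)\<close> the value \<open>lsv_pt n \<omega> powr - \<alpha>0\<close> is \<open>\<alpha>0 * 2 powr \<alpha>0\<close> times the number of indices
  below \<open>n\<close> at which \<open>\<omega>\<close> takes the value \<open>\<alpha>0\<close>. By the strong law of large numbers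
  (Hoeffding's inequality and Borel--Cantelli), that number is asymptotic to \<open>p1 * n\<close>.
\<close>

section \<open>A strong law of large numbers for bounded variables\<close>

text \<open>Independence amounts to the joint law being the product of the marginals, and reindexing
  a product measure along an injection yields exactly that product. Taking \<open>f = int\<close>
  later selects a one-sided sequence from a two-sided one.\<close>

lemma indep_vars_PiM_reindex:
  assumes M: "\<And>i. i \<in> K \<Longrightarrow> prob_space (M i)"
    and f: "inj_on f I" "f \<in> I \<rightarrow> K"
  shows "prob_space.indep_vars (PiM K M) (\<lambda>i. M (f i)) (\<lambda>i \<omega>. \<omega> (f i)) I"
proof (cases "I = {}")
  case True
  interpret prob_space "PiM K M" by (rule prob_space_PiM) (rule M)
  show ?thesis using True by (simp add: indep_vars_def indep_sets_def)
next
  case False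
  interpret prob_space "PiM K M" by (rule prob_space_PiM) (rule M)
  have fK: "f i \<in> K" if "i \<in> I" for i using f(2) that by auto
  have "distr (PiM K M) (M (f i)) (\<lambda>\<omega>. \<omega> (f i)) = M (f i)" if "i \<in> I" for i
    using that by (intro distr_PiM_component M fK)
  then have "(\<Pi>\<^sub>M i\<in>I. distr (PiM K M) (M (f i)) (\<lambda>\<omega>. \<omega> (f i))) = (\<Pi>\<^sub>M i\<in>I. M (f i))"
    by (intro PiM_cong) auto
  moreover have "distr (PiM K M) (\<Pi>\<^sub>M i\<in>I. M (f i)) (\<lambda>\<omega>. \<lambda>i\<in>I. \<omega> (f i)) = (\<Pi>\<^sub>M i\<in>I. M (f i))"
    by (rule distr_PiM_reindex) (use M f in auto)
  ultimately show ?thesis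
    by (subst indep_vars_iff_distr_eq_PiM'[OF False]) (simp_all add: measurable_component_singleton fK)
qed

lemma (in prob_space) strong_law_bounded:
  fixes X :: "nat \<Rightarrow> 'a \<Rightarrow> real"
  assumes indep: "indep_vars (\<lambda>_. borel) X UNIV"
    and bounds: "\<And>i. AE x in M. X i x \<in> {a..b}" and "a < b"
    and mean: "\<And>i. expectation (X i) = \<mu>"
  shows "AE x in M. (\<lambda>n. (\<Sum>i<n. X i x) / real n) \<longlonglongrightarrow> \<mu>"
proof -
  have [measurable]: "random_variable borel (X i)" for i
    using indep by (simp add: indep_vars_def)
  have tail: "AE x in M. \<forall>\<^sub>F n in sequentially. \<bar>(\<Sum>i<n. X i x) / real n - \<mu>\<bar> < \<epsilon>" if "\<epsilon> > 0" for \<epsilon>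
  proof -
    define A where "A n = {x \<in> space M. \<bar>(\<Sum>i<n. X i x) - real n * \<mu>\<bar> \<ge> real n * \<epsilon>}" for n
    \<comment> \<open>Hoeffding's exponent for \<open>n\<close> variables at deviation
      \<open>real n * \<epsilon>\<close> is linear in \<open>n\<close>; \<open>r\<close> is the
      resulting ratio, so the tails are dominated by a summable geometric series.\<close>
    define r where "r = exp (- 2 * \<epsilon>\<^sup>2 / (b - a)\<^sup>2)"
    have [measurable]: "A n \<in> events" for n unfolding A_def by measurable
    have bound: "prob (A n) \<le> 2 * r ^ n" if n: "n > 0" for n
    proof -
      interpret Hoeffding_ineq M "{..<n}" X "\<lambda>_. a" "\<lambda>_. b" "\<Sum>i<n. expectation (X i)"
        by unfold_locales (use bounds indep_vars_subset[OF indep] in auto)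
      have "prob (A n) \<le> 2 * exp (- 2 * (real n * \<epsilon>)\<^sup>2 / (\<Sum>i<n. (b - a)\<^sup>2))"
        unfolding A_def using Hoeffding_ineq_abs_ge[of "real n * \<epsilon>"] n \<open>a < b\<close> \<open>\<epsilon> > 0\<close>
        by (simp add: mean)
      also have "- 2 * (real n * \<epsilon>)\<^sup>2 / (\<Sum>i<n. (b - a)\<^sup>2) = real n * (- 2 * \<epsilon>\<^sup>2 / (b - a)\<^sup>2)"
        using n \<open>a < b\<close> by (simp add: power2_eq_square)
      also have "exp \<dots> = r ^ n" unfolding r_def by (rule exp_of_nat_mult)
      finally show ?thesis .
    qed
    have "r < 1" "0 \<le> r" using \<open>a < b\<close> \<open>\<epsilon> > 0\<close> by (auto simp: r_def)
    then have "summable (\<lambda>n. 2 * r ^ n)" by (intro summable_mult summable_geometric) auto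
    moreover have "\<forall>\<^sub>F n in sequentially. norm (prob (A n)) \<le> 2 * r ^ n"
      using eventually_gt_at_top[of 0] by eventually_elim (simp add: bound)
    ultimately have "summable (\<lambda>n. prob (A n))" by (rule summable_comparison_test_ev[rotated])
    then have "AE x in M. \<forall>\<^sub>F n in sequentially. x \<in> space M - A n"
      by (intro borel_cantelli_AE1) (auto simp: emeasure_eq_measure)
    then show ?thesis
    proof eventually_elim
      case (elim x)
      from elim eventually_gt_at_top[of 0] show ?case
      proof eventually_elim
        case (elim n)
        then have "\<bar>(\<Sum>i<n. X i x) - real n * \<mu>\<bar> < real n * \<epsilon>"
          by (auto simp: A_def)
        moreover have "(\<Sum>i<n. X i x) / real n - \<mu> = ((\<Sum>i<n. X i x) - real n * \<mu>) / real n"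
          using elim by (simp add: diff_divide_distrib)
        ultimately show ?case using elim by (simp add: pos_divide_less_eq mult.commute)
      qed
    qed
  qed
  \<comment> \<open>The exceptional null set depends on \<open>\<epsilon>\<close>, so
    \<open>\<epsilon>\<close> is restricted to a countable sequence tending to 0.\<close>
  have "AE x in M. \<forall>k::nat. \<forall>\<^sub>F n in sequentially.
      \<bar>(\<Sum>i<n. X i x) / real n - \<mu>\<bar> < 1 / real (Suc k)"
    by (subst AE_all_countable) (auto intro!: tail)
  then show ?thesis
  proof eventually_elim
    case (elim x)
    show ?case
    proof (rule tendstoI)
      fix e :: real assume "e > 0"
      then obtain k :: nat where "1 / real (Suc k) < e"
        using reals_Archimedean by (auto simp: inverse_eq_divide)
      then show "\<forall>\<^sub>F n in sequentially. dist ((\<Sum>i<n. X i x) / real n) \<mu> < e"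
        using elim[rule_format, of k] by (auto simp: dist_real_def elim!: eventually_mono)
    qed
  qed
qed

section \<open>Backward orbits of the left branches\<close>

lemma lsv_left: "x \<le> 1/2 \<Longrightarrow> 0 \<le> x \<Longrightarrow> lsv \<alpha> x = x * (1 + (2 * x) powr \<alpha>)"
  by (simp add: lsv_def powr_mult)

text \<open>Later arguments know the inverse branch only through this implicit equation and the
  location of its solution.\<close>

lemma lsv_inverse_branch:
  assumes "0 < \<alpha>" "0 < x" "x \<le> 1"
  defines "y \<equiv> the_inv_into {0<..1/2} (lsv \<alpha>) x"
  shows "0 < y" "y \<le> 1/2" "y * (1 + (2 * y) powr \<alpha>) = x"
proof -
  note bij = lsv_bij_betw[OF \<open>0 < \<alpha>\<close>]
  have "y \<in> {0<..1/2}"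
    unfolding y_def using bij_betw_the_inv_into[OF bij] assms(2,3) by (auto dest: bij_betwE)
  moreover have "lsv \<alpha> y = x"
    unfolding y_def using assms(2,3) by (intro f_the_inv_into_f_bij_betw[OF bij]) auto
  ultimately show "0 < y" "y \<le> 1/2" "y * (1 + (2 * y) powr \<alpha>) = x"
    by (auto simp: lsv_left)
qed

lemma lsv_pt_range:
  assumes "\<And>i. 0 < \<omega> i"
  shows "0 < lsv_pt (Suc n) \<omega> \<and> lsv_pt (Suc n) \<omega> \<le> 1/2"
  using assms
proof (induction n arbitrary: \<omega>)
  case (Suc n)
  have "0 < lsv_pt (Suc n) (shift \<omega>) \<and> lsv_pt (Suc n) (shift \<omega>) \<le> 1/2"
    by (rule Suc.IH) (simp add: shift_def Suc.prems)
  then show ?case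
    using lsv_inverse_branch(1,2)[OF Suc.prems[of 0], of "lsv_pt (Suc n) (shift \<omega>)"] by simp
qed simp

lemma lsv_pt_step:
  assumes "\<And>i. 0 < \<omega> i"
  shows "lsv_pt (Suc (Suc n)) \<omega> * (1 + (2 * lsv_pt (Suc (Suc n)) \<omega>) powr \<omega> 0)
           = lsv_pt (Suc n) (shift \<omega>)"
  using lsv_inverse_branch(3)[OF assms[of 0], of "lsv_pt (Suc n) (shift \<omega>)"]
    lsv_pt_range[of "shift \<omega>" n] assms
  by (simp add: shift_def)

text \<open>Since \<open>2 y \<le> 1\<close> and the exponents are at most 1, each step dominates that of the
  map \<open>y (1 + 2 y)\<close>; this gives a decay to zero that is uniform in \<open>\<omega>\<close>.\<close>
lemma lsv_pt_upper:
  assumes "\<And>i. 0 < \<omega> i" "\<And>i. \<omega> i \<le> 1"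
  shows "lsv_pt (Suc n) \<omega> \<le> 1 / real (n + 2)"
  using assms
proof (induction n arbitrary: \<omega>)
  case (Suc n)
  define y where "y = lsv_pt (Suc (Suc n)) \<omega>"
  have y: "0 < y" "y \<le> 1/2" using lsv_pt_range[of \<omega> "Suc n"] Suc.prems by (auto simp: y_def simp del: lsv_pt.simps)
  have IH: "lsv_pt (Suc n) (shift \<omega>) \<le> 1 / real (n + 2)"
    by (rule Suc.IH) (simp_all add: shift_def Suc.prems)
  have "(2 * y) powr 1 \<le> (2 * y) powr \<omega> 0"
    using y Suc.prems by (intro powr_mono') auto
  then have "y * (1 + 2 * y) \<le> y * (1 + (2 * y) powr \<omega> 0)"
    using y by (intro mult_left_mono) auto
  also have "\<dots> \<le> 1 / real (n + 2)"
    using lsv_pt_step[of \<omega> n, OF Suc.prems(1)] IH by (simp add: y_def del: lsv_pt.simps)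
  finally have le: "y * (1 + 2 * y) \<le> 1 / real (n + 2)" .
  \<comment> \<open>The map \<open>y * (1 + 2 * y)\<close> is increasing, and at
    \<open>z = 1 / (n + 3)\<close> it is already at least \<open>1 / (n + 2)\<close>, because
    \<open>(n + 5) * (n + 2)\<close> exceeds the square of \<open>n + 3\<close> by
    \<open>n + 1\<close>.\<close>
  have "y \<le> 1 / real (n + 3)"
  proof (rule ccontr)
    define z where "z = 1 / real (n + 3)"
    assume "\<not> y \<le> 1 / real (n + 3)"
    then have "z < y" "0 < z" by (auto simp: z_def)
    then have "z * (1 + 2 * z) < y * (1 + 2 * y)"
      by (intro mult_strict_mono) auto
    moreover have "1 / real (n + 2) \<le> z * (1 + 2 * z)"
      by (simp add: z_def divide_simps) (simp add: algebra_simps)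
    ultimately show False using le by simp
  qed
  then show ?case by (simp add: y_def add_ac)
qed simp

text \<open>On the left half \<open>(2 * y) powr \<alpha> \<le> 1\<close>, so a branch at most
  doubles a point. This bounds \<open>x powr - a\<close> at the finitely many early indices,
  uniformly in \<open>\<omega>\<close>.\<close>

lemma lsv_pt_lower:
  assumes "\<And>i. 0 < \<omega> i"
  shows "(1/2) ^ Suc n \<le> lsv_pt (Suc n) \<omega>"
  using assms
proof (induction n arbitrary: \<omega>)
  case (Suc n)
  define y where "y = lsv_pt (Suc (Suc n)) \<omega>"
  have y: "0 < y" "y \<le> 1/2" using lsv_pt_range[of \<omega> "Suc n"] Suc.prems by (auto simp: y_def simp del: lsv_pt.simps)
  have "(1/2) ^ Suc n \<le> lsv_pt (Suc n) (shift \<omega>)"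
    by (rule Suc.IH) (simp add: shift_def Suc.prems)
  also have "\<dots> = y * (1 + (2 * y) powr \<omega> 0)"
    using lsv_pt_step[of \<omega> n, OF Suc.prems] by (simp add: y_def del: lsv_pt.simps)
  also have "\<dots> \<le> y * 2"
    using y Suc.prems[of 0] by (intro mult_left_mono) (auto intro!: powr_le1)
  finally show ?case by (simp add: y_def)
qed simp

section \<open>Linear growth of the power \<open>x powr - a\<close> along backward orbits\<close>

text \<open>To first order, \<open>(1 + (2 * y) powr a) powr - a\<close> is
  \<open>1 - a * (2 * y) powr a\<close>; the factor \<open>y powr - a\<close> cancels the power of
  \<open>y\<close> exactly.\<close>

lemma powr_gain_same:
  fixes a :: real
  assumes "0 < a"
  shows "((\<lambda>y. y powr - a - (y * (1 + (2 * y) powr a)) powr - a) \<longlongrightarrow> a * 2 powr a) (at_right 0)"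
  using assms by real_asymp

text \<open>The same expansion leaves a term of order \<open>y powr (b - a)\<close>, which
  vanishes.\<close>

lemma powr_gain_bigger:
  fixes a b :: real
  assumes "0 < a" "a < b"
  shows "((\<lambda>y. y powr - a - (y * (1 + (2 * y) powr b)) powr - a) \<longlongrightarrow> 0) (at_right 0)"
  using assms by real_asymp

text \<open>The constant \<open>C\<close> serves all \<open>\<omega>\<close> at once, since the
  induction on \<open>n\<close> compares \<open>\<omega>\<close> with
  \<open>shift \<omega>\<close>.\<close>

lemma lsv_pt_powr_linear:
  fixes a b \<epsilon> :: real
  assumes "0 < a" "a < b" "b \<le> 1" "0 < \<epsilon>"
  obtains C where "\<And>n \<omega>. (\<And>i. \<omega> i = a \<or> \<omega> i = b) \<Longrightarrow>
    \<bar>lsv_pt (Suc n) \<omega> powr - a - a * 2 powr a * (\<Sum>i<n. indicator {a} (\<omega> (int i)))\<bar>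
      \<le> C + \<epsilon> * real n"
proof -
  define c where "c = a * 2 powr a"
  define D where "D n \<omega> = lsv_pt (Suc n) \<omega> powr - a - c * (\<Sum>i<n. indicator {a} (\<omega> (int i)))" for n \<omega>
  have "c > 0" using assms by (simp add: c_def)
  define G where "G t y = y powr - a - (y * (1 + (2 * y) powr t)) powr - a" for t y :: real
  have "\<forall>\<^sub>F y in at_right 0. \<bar>G a y - c\<bar> < \<epsilon> \<and> \<bar>G b y\<bar> < \<epsilon>"
    using tendstoD[OF powr_gain_same[OF assms(1)] assms(4)]
      tendstoD[OF powr_gain_bigger[OF assms(1,2)] assms(4)]
    by eventually_elim (simp add: G_def c_def dist_real_def)
  then obtain \<delta> where \<delta>: "\<delta> > 0" "\<And>y. 0 < y \<Longrightarrow> y < \<delta> \<Longrightarrow> \<bar>G a y - c\<bar> < \<epsilon> \<and> \<bar>G b y\<bar> < \<epsilon>"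
    by (auto simp: eventually_at_right_field)
  \<comment> \<open>By the uniform decay, all points of index beyond \<open>K\<close> lie below
    \<open>\<delta>\<close>, whatever \<open>\<omega>\<close> is.\<close>
  obtain K :: nat where K: "1 / real (Suc K) < \<delta>"
    using reals_Archimedean[OF \<delta>(1)] by (auto simp: inverse_eq_divide)
  have step: "\<bar>D (Suc n) \<omega> - D n (shift \<omega>)\<bar> \<le> \<epsilon>"
    if \<omega>: "\<And>i. \<omega> i = a \<or> \<omega> i = b" and n: "n \<ge> K" for n \<omega>
  proof -
    define y where "y = lsv_pt (Suc (Suc n)) \<omega>"
    have pos: "0 < \<omega> i" and le1: "\<omega> i \<le> 1" for i using \<omega>[of i] assms by auto
    have "0 < y" using lsv_pt_range[of \<omega> "Suc n", OF pos] by (simp add: y_def del: lsv_pt.simps)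
    have "y \<le> 1 / real (Suc n + 2)" unfolding y_def by (rule lsv_pt_upper[OF pos le1])
    also have "\<dots> \<le> 1 / real (Suc K)" using n by (intro divide_left_mono) auto
    finally have "y < \<delta>" using K by linarith
    \<comment> \<open>The first summand is split off, not the last: one pullback uses the exponent
      \<open>\<omega> 0\<close> and leaves the orbit of \<open>shift \<omega>\<close>.\<close>
    have "(\<Sum>i<Suc n. indicator {a} (\<omega> (int i)) :: real)
        = indicator {a} (\<omega> 0) + (\<Sum>i<n. indicator {a} (shift \<omega> (int i)))"
      by (subst sum.lessThan_Suc_shift) (simp add: shift_def add.commute)
    then have "D (Suc n) \<omega> - D n (shift \<omega>) = G (\<omega> 0) y - c * indicator {a} (\<omega> 0)"
      using lsv_pt_step[of \<omega> n, OF pos] by (simp add: D_def G_def y_def algebra_simps del: lsv_pt.simps)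
    then show ?thesis
      using \<omega>[of 0] \<delta>(2)[OF \<open>0 < y\<close> \<open>y < \<delta>\<close>] assms(2) by (auto simp: indicator_def)
  qed
  have N: "0 \<le> (\<Sum>i<n. indicator {a} (\<omega> (int i)) :: real)"
      "(\<Sum>i<n. indicator {a} (\<omega> (int i)) :: real) \<le> real n" for n and \<omega> :: "int \<Rightarrow> real"
    using sum_bounded_above[of "{..<n}" "\<lambda>i. indicator {a} (\<omega> (int i)) :: real" 1]
    by (auto intro!: sum_nonneg simp: indicator_def)
  define C where "C = ((1/2) ^ Suc K) powr - a + c * real K"
  have small: "\<bar>D n \<omega>\<bar> \<le> C" if \<omega>: "\<And>i. \<omega> i = a \<or> \<omega> i = b" and n: "n \<le> K" for n \<omega>
  proof -
    have pos: "0 < \<omega> i" for i using \<omega>[of i] assms by auto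
    have "(1/2) ^ Suc K \<le> ((1/2) ^ Suc n :: real)" using n by (intro power_decreasing) auto
    also have "\<dots> \<le> lsv_pt (Suc n) \<omega>" by (rule lsv_pt_lower[OF pos])
    finally have "lsv_pt (Suc n) \<omega> powr - a \<le> ((1/2) ^ Suc K) powr - a"
      using assms by (intro powr_mono2') auto
    moreover have "0 \<le> lsv_pt (Suc n) \<omega> powr - a" by simp
    moreover have "c * (\<Sum>i<n. indicator {a} (\<omega> (int i))) \<le> c * real K"
      using N(2)[where n = n and \<omega> = \<omega>] n \<open>c > 0\<close> by (intro mult_left_mono) auto
    moreover have "0 \<le> c * (\<Sum>i<n. indicator {a} (\<omega> (int i)))"
      using N(1) \<open>c > 0\<close> by simp
    ultimately show ?thesis unfolding D_def C_def by linarith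
  qed
  have main: "\<bar>D n \<omega>\<bar> \<le> C + \<epsilon> * real n" if "\<And>i. \<omega> i = a \<or> \<omega> i = b" for n \<omega>
    using that
  proof (induction n arbitrary: \<omega>)
    case 0
    then show ?case using small[of \<omega> 0] by simp
  next
    case (Suc n)
    show ?case
    proof (cases "n \<ge> K")
      case True
      have "\<bar>D n (shift \<omega>)\<bar> \<le> C + \<epsilon> * real n"
        by (rule Suc.IH) (simp add: shift_def Suc.prems)
      then show ?thesis using step[of \<omega> n, OF Suc.prems True] by (simp add: algebra_simps)
    next
      case False
      then have "\<bar>D (Suc n) \<omega>\<bar> \<le> C" by (intro small Suc.prems) auto
      then show ?thesis using assms(4) by (smt (verit) mult_nonneg_nonneg of_nat_0_le_iff)
    qed
  qed
  show ?thesis by (rule that[of C]) (use main in \<open>simp add: D_def c_def\<close>)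
qed

text \<open>This is the deterministic half, for a single \<open>\<omega>\<close>: the power grows
  linearly at rate \<open>a * 2 powr a * p\<close>, and raising to \<open>- (1 / a)\<close> recovers
  the point.\<close>

lemma lsv_pt_asymp_equiv:
  fixes a b p :: real
  assumes "0 < a" "a < b" "b \<le> 1" "0 < p"
    and \<omega>: "\<And>i. \<omega> i = a \<or> \<omega> i = b"
    and freq: "(\<lambda>n. (\<Sum>i<n. indicator {a} (\<omega> (int i))) / real n) \<longlonglongrightarrow> p"
  shows "(\<lambda>l. lsv_pt l \<omega>) \<sim>[sequentially] (\<lambda>l. (1 / ((a * 2 powr a * p) * real l)) powr (1 / a))"
proof -
  define c where "c = a * 2 powr a"
  have "c > 0" using assms by (simp add: c_def)
  define Z where "Z n = lsv_pt (Suc n) \<omega> powr - a" for n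
  define N where "N n = (\<Sum>i<n. indicator {a} (\<omega> (int i)) :: real)" for n
  have pos: "0 < \<omega> i" for i using \<omega>[of i] assms(1,2) by auto
  have "(\<lambda>n. (Z n - c * N n) / real n) \<longlonglongrightarrow> 0"
  proof (rule tendstoI)
    fix e :: real assume "e > 0"
    \<comment> \<open>Half of \<open>e\<close> pays for the slope of the error, the other half for
      \<open>C / real n\<close>.\<close>
    then obtain C where C: "\<And>n. \<bar>Z n - c * N n\<bar> \<le> C + e / 2 * real n"
      using lsv_pt_powr_linear[OF assms(1-3), of "e / 2"] \<omega> unfolding Z_def c_def N_def
      by (metis half_gt_zero)
    have "(\<lambda>n. C / real n) \<longlonglongrightarrow> 0" by real_asymp
    then have "\<forall>\<^sub>F n in sequentially. C / real n < e / 2"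
      by (rule order_tendstoD(2)) (use \<open>e > 0\<close> in simp)
    then show "\<forall>\<^sub>F n in sequentially. dist ((Z n - c * N n) / real n) 0 < e"
      using eventually_gt_at_top[of 0]
    proof eventually_elim
      case (elim n)
      have "\<bar>Z n - c * N n\<bar> / real n \<le> (C + e / 2 * real n) / real n"
        by (intro divide_right_mono C) auto
      also have "\<dots> = C / real n + e / 2" using elim by (simp add: field_simps)
      also have "\<dots> < e" using elim by linarith
      finally show ?case by (simp add: dist_real_def)
    qed
  qed
  moreover have "(\<lambda>n. c * (N n / real n)) \<longlonglongrightarrow> c * p"
    unfolding N_def by (intro tendsto_mult tendsto_const freq)
  ultimately have "(\<lambda>n. (Z n - c * N n) / real n + c * (N n / real n)) \<longlonglongrightarrow> 0 + c * p"
    by (rule tendsto_add)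
  then have "(\<lambda>n. Z n / real n) \<longlonglongrightarrow> c * p" by (simp add: diff_divide_distrib)
  \<comment> \<open>\<open>Z n\<close> belongs to the point of index \<open>Suc n\<close>; this
    factor corrects the denominator.\<close>
  moreover have "(\<lambda>n. real n / real (Suc n)) \<longlonglongrightarrow> 1" by real_asymp
  ultimately have "(\<lambda>n. Z n / real n * (real n / real (Suc n))) \<longlonglongrightarrow> c * p * 1"
    by (rule tendsto_mult)
  then have lim: "(\<lambda>n. Z n / real n * (real n / real (Suc n))) \<longlonglongrightarrow> c * p" by simp
  have "(\<lambda>n. Z n / real (Suc n)) \<longlonglongrightarrow> c * p"
    by (rule Lim_transform_eventually[OF lim])
      (use eventually_gt_at_top[of 0] in eventually_elim, simp)
  then have "(\<lambda>l. lsv_pt l \<omega> powr - a / real l) \<longlonglongrightarrow> c * p"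
    unfolding Z_def by (subst (asm) filterlim_sequentially_Suc)
  then have "(\<lambda>l. lsv_pt l \<omega> powr - a) \<sim>[sequentially] (\<lambda>l. c * p * real l)"
    by (rule asymp_equivI'_const) (use \<open>c > 0\<close> \<open>0 < p\<close> in simp)
  then have equiv: "(\<lambda>l. (lsv_pt l \<omega> powr - a) powr - (1 / a)) \<sim>[sequentially]
      (\<lambda>l. (c * p * real l) powr - (1 / a))"
    by (rule asymp_equiv_powr_real) (use \<open>c > 0\<close> \<open>0 < p\<close> in auto)
  \<comment> \<open>Nonnegativity lets the two powers cancel; at \<open>l = 0\<close> it holds by
    the dummy value 1.\<close>
  have range: "0 \<le> lsv_pt l \<omega>" for l
    using lsv_pt_range[of \<omega>, OF pos] by (cases l) (auto simp: less_imp_le)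
  show ?thesis
  proof (rule asymp_equiv_cong[THEN iffD1, OF _ _ equiv])
    show "\<forall>\<^sub>F l in sequentially. (lsv_pt l \<omega> powr - a) powr - (1 / a) = lsv_pt l \<omega>"
      using \<open>0 < a\<close> range by (simp add: powr_powr)
    show "\<forall>\<^sub>F l in sequentially. (c * p * real l) powr - (1 / a)
        = (1 / ((a * 2 powr a * p) * real l)) powr (1 / a)"
      using \<open>c > 0\<close> \<open>0 < p\<close> by (simp add: c_def powr_minus powr_divide divide_simps)
  qed
qed

theorem proposition5p5:
  fixes \<alpha>0 \<alpha>1 p1 p2 :: real
  assumes "0 < \<alpha>0" and "\<alpha>0 < \<alpha>1" and "\<alpha>1 < 1"
    and "p1 > 0" and "p2 > 0" and "p1 + p2 = 1"
  shows "AE \<omega> in PiM (UNIV :: int set) (\<lambda>_. two_point p1 \<alpha>0 p2 \<alpha>1).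
           asymp_equiv (\<lambda>l. lsv_pt l \<omega>) sequentially
             (\<lambda>l. (1 / ((\<alpha>0 * 2 powr \<alpha>0 * p1) * real l)) powr (1 / \<alpha>0))"
proof -
  define \<nu> where "\<nu> = two_point p1 \<alpha>0 p2 \<alpha>1"
  define P where "P = PiM (UNIV :: int set) (\<lambda>_. \<nu>)"
  have \<nu>: "prob_space \<nu>" unfolding \<nu>_def using assms by (intro prob_space_two_point) auto
  interpret P: prob_space P unfolding P_def by (rule prob_space_PiM) (rule \<nu>)
  have sets_\<nu>: "{\<alpha>0} \<in> sets \<nu>" "{\<alpha>0..\<alpha>1} - {\<alpha>0, \<alpha>1} \<in> sets \<nu>"
    using assms by (auto simp: \<nu>_def sets_restrict_space_iff)
  have meas: "(\<lambda>x. indicator {\<alpha>0} x :: real) \<in> borel_measurable \<nu>"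
    using sets_\<nu>(1) by (rule borel_measurable_indicator)
  have comp: "(\<lambda>\<omega>. \<omega> i) \<in> measurable P \<nu>" for i
    unfolding P_def by (rule measurable_component_singleton) simp
  \<comment> \<open>The space of \<open>\<nu>\<close> is the whole interval, so exponents other than
    the two atoms are discarded as a null set, for all of the countably many coordinates
    together.\<close>
  have "emeasure \<nu> ({\<alpha>0..\<alpha>1} - {\<alpha>0, \<alpha>1}) = 0"
    using sets_\<nu>(2) by (simp add: \<nu>_def emeasure_two_point)
  then have "AE x in \<nu>. x = \<alpha>0 \<or> x = \<alpha>1"
    using sets_\<nu>(2) by (intro AE_I[of _ _ "{\<alpha>0..\<alpha>1} - {\<alpha>0, \<alpha>1}"]) (auto simp: \<nu>_def)
  then have "AE \<omega> in P. \<omega> i = \<alpha>0 \<or> \<omega> i = \<alpha>1" for i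
    unfolding P_def by (intro AE_PiM_component \<nu>) auto
  then have two_valued: "AE \<omega> in P. \<forall>i. \<omega> i = \<alpha>0 \<or> \<omega> i = \<alpha>1" by (simp add: AE_all_countable)
  \<comment> \<open>Only coordinates of nonnegative index are counted, as the backward orbit reads
    no others.\<close>
  have "AE \<omega> in P. (\<lambda>n. (\<Sum>i<n. indicator {\<alpha>0} (\<omega> (int i))) / real n) \<longlonglongrightarrow> p1"
  proof (rule P.strong_law_bounded[where a = 0 and b = 1])
    have "P.indep_vars (\<lambda>_. \<nu>) (\<lambda>i \<omega>. \<omega> (int i)) UNIV"
      unfolding P_def by (rule indep_vars_PiM_reindex) (auto intro: \<nu>)
    then show "P.indep_vars (\<lambda>_. borel) (\<lambda>i \<omega>. indicator {\<alpha>0} (\<omega> (int i)) :: real) UNIV"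
      by (rule P.indep_vars_compose2) (rule meas)
  next
    fix i :: nat
    have "P.expectation (\<lambda>\<omega>. indicator {\<alpha>0} (\<omega> (int i)) :: real)
        = (\<integral>x. indicator {\<alpha>0} x \<partial>distr P \<nu> (\<lambda>\<omega>. \<omega> (int i)))"
      by (subst integral_distr[OF comp meas]) (rule refl)
    also have "distr P \<nu> (\<lambda>\<omega>. \<omega> (int i)) = \<nu>"
      unfolding P_def by (intro distr_PiM_component \<nu>) auto
    also have "(\<integral>x. indicator {\<alpha>0} x \<partial>\<nu>) = measure \<nu> {\<alpha>0}"
      using assms by (simp add: \<nu>_def)
    also have "\<dots> = p1"
      using sets_\<nu>(1) assms by (simp add: measure_def \<nu>_def emeasure_two_point)
    finally show "P.expectation (\<lambda>\<omega>. indicator {\<alpha>0} (\<omega> (int i))) = p1" .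
  qed (auto simp: indicator_def)
  with two_valued have "AE \<omega> in P. (\<lambda>l. lsv_pt l \<omega>) \<sim>[sequentially]
      (\<lambda>l. (1 / ((\<alpha>0 * 2 powr \<alpha>0 * p1) * real l)) powr (1 / \<alpha>0))"
    by eventually_elim (rule lsv_pt_asymp_equiv[where b = \<alpha>1], use assms in auto)
  then show ?thesis unfolding P_def \<nu>_def .
qed

end
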